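(* Let $W$ be a Sturmian word and let $n$ be a positive integer. Then the volume of the simplex in $\mathbb{R}^n$ whose $n+1$ vertices are the $n+1$ elements of $F_n(W)$ is $\frac{1}{n!}$.
   Context: A binary word is a map $W$ from the nonnegative integers into $\{0,1\}$. For a positive integer $n$, the set of factors of length $n$ of $W$ is $F_n(W) := \{(W(i),W(i+1),\dots,W(i+n-1))^T : i\ge 0\}\subset\mathbb{R}^n$. A Sturmian word is a binary word $W$ such that $|F_n(W)|=n+1$ for every positive integer $n$. The simplex is the convex hull of the $n+1$ points of $F_n(W)$, and volume means $n$-dimensional volume (Lebesgue measure). *)

theory Defs
  imports "HOL-Analysis.Analysis"
begin

text \<open>
  The length-\<open>n\<close> factors are lists rather than vectors, because a Sturmian word constrains
  them for all \<open>n\<close> at once, whereas the dimension of \<open>real ^ 'n\<close> is fixed by a type.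
\<close>

definition binary_word :: "(nat \<Rightarrow> real) \<Rightarrow> bool" where
  "binary_word W \<longleftrightarrow> range W \<subseteq> {0, 1}"

definition factors :: "nat \<Rightarrow> (nat \<Rightarrow> real) \<Rightarrow> real list set" where
  "factors n W = {map W [i..<i + n] | i. True}"

definition sturmian :: "(nat \<Rightarrow> real) \<Rightarrow> bool" where
  "sturmian W \<longleftrightarrow> binary_word W \<and> (\<forall>n\<ge>1. card (factors n W) = n + 1)"

text \<open>
  The index type of \<open>real ^ 'n\<close> carries no order. A bijection \<open>e\<close> from \<open>'n\<close> onto \<open>{..<n}\<close> tells
  which (zero-based) coordinate each index stands for, so that it identifies lists of
  length \<open>n\<close> with points of \<open>real ^ 'n\<close>.
\<close>

definition vec_of_list :: "('n::finite \<Rightarrow> nat) \<Rightarrow> real list \<Rightarrow> real ^ 'n" where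
  "vec_of_list e xs = (\<chi> k. xs ! e k)"

end

theory Submission
  imports Defs
begin

text \<open>
  A simplex with integer vertices \<open>x\<^sub>0, \<dots>, x\<^sub>n\<close> has volume \<open>\<bar>det M\<bar> / n!\<close>, where the columns of \<open>M\<close>
  are the edge vectors \<open>x\<^sub>j - x\<^sub>0\<close>. If the edge vectors generate the lattice \<open>\<int>\<^sup>n\<close>, then \<open>M\<close> has an
  inverse with integer entries, its determinant is a unit of \<open>\<int>\<close>, and the volume is \<open>1 / n!\<close>. So it
  suffices that the differences of the length-\<open>n\<close> factors of a Sturmian word generate \<open>\<int>\<^sup>n\<close>.

  This holds by induction on \<open>n\<close> (\<open>unit_vector_factor_combination\<close>). Deleting the last letter maps the
  \<open>n + 2\<close> factors of length \<open>n + 1\<close> onto the \<open>n + 1\<close> factors of length \<open>n\<close>. By the pigeonhole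
  principle some factor \<open>w\<close> extends to both \<open>w0\<close> and \<open>w1\<close> (\<open>right_special_factor\<close>), and the difference
  of these is the last unit vector. A combination of factors of length \<open>n\<close> that gives another unit
  vector lifts to length \<open>n + 1\<close>, where it is correct up to an integer multiple of the last
  unit vector, which can be subtracted.

  The volume formula \<open>content_simplex\<close> is about spaces \<open>real ^ 'm\<close> with a well-ordered index type, whereas
  \<open>'n\<close> is any finite type. Renaming the coordinates preserves Lebesgue measure
  (\<open>measure_reindex_coordinates\<close>), so an ordered copy of \<open>'n\<close> can serve as index type.
\<close>

section \<open>Integer affine combinations of factors\<close>

lemma card_factors:
  assumes "sturmian W"
  shows "card (factors m W) = m + 1"
proof (cases "m = 0")
  case True
  have "factors 0 W = {[]}" by (auto simp: factors_def)
  then show ?thesis using True by simp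
next
  case False
  then show ?thesis using assms by (simp add: sturmian_def)
qed

lemma finite_factors:
  assumes "sturmian W"
  shows "finite (factors m W)"
  by (rule card_ge_0_finite) (simp add: card_factors[OF assms])

lemma length_factor: "xs \<in> factors m W \<Longrightarrow> length xs = m"
  by (auto simp: factors_def)

lemma nth_factor_binary:
  assumes "sturmian W" "xs \<in> factors m W" "i < m"
  shows "xs ! i = 0 \<or> xs ! i = 1"
proof -
  obtain j where "xs = map W [j..<j + m]" using assms(2) by (auto simp: factors_def)
  then have "xs ! i = W (j + i)" using assms(3) by simp
  then show ?thesis using assms(1) by (auto simp: sturmian_def binary_word_def)
qed

lemma nth_factor_Ints:
  assumes "sturmian W" "xs \<in> factors m W" "i < m"
  shows "xs ! i \<in> \<int>"
  using nth_factor_binary[OF assms] by auto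

lemma butlast_factor: "ys \<in> factors (Suc m) W \<Longrightarrow> butlast ys \<in> factors m W"
  by (auto simp: factors_def)

lemma factor_extends:
  assumes "xs \<in> factors m W"
  obtains ys where "ys \<in> factors (Suc m) W" "butlast ys = xs"
proof -
  obtain j where j: "xs = map W [j..<j + m]" using assms by (auto simp: factors_def)
  have "map W [j..<j + Suc m] \<in> factors (Suc m) W" by (auto simp: factors_def)
  moreover have "butlast (map W [j..<j + Suc m]) = xs" by (simp add: j)
  ultimately show ?thesis using that by blast
qed

text \<open>
  There are more factors of length \<open>m + 1\<close> than of length \<open>m\<close>, so deleting the last letter must identify
  two of them.
\<close>

lemma right_special_factor:
  assumes "sturmian W"
  obtains xs where "xs @ [0] \<in> factors (Suc m) W" "xs @ [1] \<in> factors (Suc m) W"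
proof -
  have "\<not> inj_on butlast (factors (Suc m) W)"
  proof
    assume "inj_on butlast (factors (Suc m) W)"
    then have "card (factors (Suc m) W) \<le> card (factors m W)"
      using butlast_factor finite_factors[OF assms] by (intro card_inj_on_le) auto
    then show False by (simp add: card_factors[OF assms])
  qed
  then obtain ys zs where yz: "ys \<in> factors (Suc m) W" "zs \<in> factors (Suc m) W"
      "butlast ys = butlast zs" "ys \<noteq> zs"
    by (auto simp: inj_on_def)
  have split: "us = butlast us @ [0] \<or> us = butlast us @ [1]" if "us \<in> factors (Suc m) W" for us
  proof -
    have len: "length us = Suc m" using length_factor[OF that] .
    then have "us \<noteq> []" by auto
    moreover from this have "last us = us ! m" using len by (simp add: last_conv_nth)
    ultimately show ?thesis
      using nth_factor_binary[OF assms that, of m] append_butlast_last_id[of us] by fastforce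
  qed
  define w where "w = butlast ys"
  have "ys = w @ [0] \<or> ys = w @ [1]" "zs = w @ [0] \<or> zs = w @ [1]"
    using split[OF yz(1)] split[OF yz(2)] unfolding w_def yz(3) .
  then show ?thesis using yz that[of w] by auto
qed

text \<open>
  Integer combinations with coefficient sum zero are the elements of the lattice that the differences
  of factors generate. In this form no base point has to be chosen among the factors, which would not
  be compatible with passing from length \<open>m\<close> to length \<open>m + 1\<close>. The last unit vector is
  \<open>w1 - w0\<close> for a right special \<open>w\<close>; the others are lifted from length \<open>m\<close> and corrected in the last
  coordinate.
\<close>

lemma unit_vector_factor_combination:
  assumes "sturmian W" "k < m"
  shows "\<exists>c :: real list \<Rightarrow> int. (\<Sum>xs\<in>factors m W. c xs) = 0 \<and>
           (\<forall>i<m. (\<Sum>xs\<in>factors m W. of_int (c xs) * xs ! i) = (if i = k then 1 else 0))"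
  using assms(2)
proof (induction m arbitrary: k)
  case 0
  then show ?case by simp
next
  case (Suc m)
  let ?F = "factors m W" and ?G = "factors (Suc m) W"
  note fin = finite_factors[OF assms(1)]
  obtain w where w: "w @ [0] \<in> ?G" "w @ [1] \<in> ?G"
    using right_special_factor[OF assms(1)] by blast
  have lenw: "length w = m" using length_factor[OF w(1)] by simp
  \<comment> \<open>the coefficients of \<open>w1 - w0\<close>\<close>
  define d :: "real list \<Rightarrow> int" where
    "d = (\<lambda>ys. of_bool (ys = w @ [1]) - of_bool (ys = w @ [0]))"
  have d0: "(\<Sum>ys\<in>?G. d ys) = 0"
    using w fin by (simp add: d_def sum_subtractf of_bool_def)
  have d1: "(\<Sum>ys\<in>?G. of_int (d ys) * ys ! i) = (if i = m then 1 else 0)" if "i < Suc m" for i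
  proof -
    have "(\<Sum>ys\<in>?G. of_int (d ys) * ys ! i)
        = (\<Sum>ys\<in>?G. (if ys = w @ [1] then ys ! i else 0) - (if ys = w @ [0] then ys ! i else 0))"
      by (rule sum.cong) (auto simp: d_def)
    also have "\<dots> = (w @ [1]) ! i - (w @ [0]) ! i"
      using w fin by (simp add: sum_subtractf)
    also have "\<dots> = (if i = m then 1 else 0)"
      using that lenw by (auto simp: nth_append)
    finally show ?thesis .
  qed
  show ?case
  proof (cases "k = m")
    case True
    then show ?thesis using d0 d1 by blast
  next
    case False
    then have "k < m" using Suc.prems by simp
    from Suc.IH[OF this] obtain c :: "real list \<Rightarrow> int" where
      c0: "(\<Sum>xs\<in>?F. c xs) = 0" and
      c1: "\<And>i. i < m \<Longrightarrow> (\<Sum>xs\<in>?F. of_int (c xs) * xs ! i) = (if i = k then 1 else 0)"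
      by blast
    have "\<forall>xs\<in>?F. \<exists>ys. ys \<in> ?G \<and> butlast ys = xs" by (blast elim: factor_extends)
    from bchoice[OF this] obtain s where
      s: "\<And>xs. xs \<in> ?F \<Longrightarrow> s xs \<in> ?G \<and> butlast (s xs) = xs"
      by blast
    have inj: "inj_on s ?F" by (rule inj_on_inverseI[of _ butlast]) (simp add: s)
    have sub: "s ` ?F \<subseteq> ?G" using s by auto
    \<comment> \<open>the combination for length \<open>m\<close>, with each factor replaced by a chosen extension\<close>
    define b where "b = (\<lambda>ys. if ys \<in> s ` ?F then c (butlast ys) else 0)"
    have push: "(\<Sum>ys\<in>?G. of_int (b ys) * g ys) = (\<Sum>xs\<in>?F. of_int (c xs) * g (s xs))"
      for g :: "real list \<Rightarrow> real"
    proof -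
      have "(\<Sum>ys\<in>?G. of_int (b ys) * g ys) = (\<Sum>ys\<in>s ` ?F. of_int (b ys) * g ys)"
        using sub fin by (intro sum.mono_neutral_right) (auto simp: b_def)
      also have "\<dots> = (\<Sum>xs\<in>?F. of_int (b (s xs)) * g (s xs))"
        using inj by (simp add: sum.reindex)
      also have "\<dots> = (\<Sum>xs\<in>?F. of_int (c xs) * g (s xs))"
        using s by (intro sum.cong) (auto simp: b_def)
      finally show ?thesis .
    qed
    have b0: "(\<Sum>ys\<in>?G. b ys) = 0"
    proof -
      have "real_of_int (\<Sum>ys\<in>?G. b ys) = real_of_int (\<Sum>xs\<in>?F. c xs)"
        using push[of "\<lambda>_. 1"] by simp
      then show ?thesis unfolding c0 of_int_0 of_int_eq_0_iff .
    qed
    have b1: "(\<Sum>ys\<in>?G. of_int (b ys) * ys ! i) = (if i = k then 1 else 0)" if "i < m" for i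
    proof -
      have "s xs ! i = xs ! i" if "xs \<in> ?F" for xs
        using nth_butlast[of i "s xs"] s[OF that] length_factor[OF that] \<open>i < m\<close> by simp
      then show ?thesis
        using push[of "\<lambda>ys. ys ! i"] c1[OF that] by simp
    qed
    \<comment> \<open>the lift has an uncontrolled last coordinate \<open>z\<close>, but an integral one\<close>
    have "(\<Sum>ys\<in>?G. of_int (b ys) * ys ! m) \<in> \<int>"
      using nth_factor_Ints[OF assms(1)] by (intro Ints_sum Ints_mult) auto
    then obtain z where z: "(\<Sum>ys\<in>?G. of_int (b ys) * ys ! m) = real_of_int z"
      by (auto elim: Ints_cases)
    have "(\<Sum>ys\<in>?G. b ys - z * d ys) = 0"
      by (simp add: sum_subtractf b0 d0 flip: sum_distrib_left)
    moreover have "(\<Sum>ys\<in>?G. of_int (b ys - z * d ys) * ys ! i) = (if i = k then 1 else 0)"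
      if "i < Suc m" for i
    proof -
      have "(\<Sum>ys\<in>?G. of_int (b ys - z * d ys) * ys ! i)
          = (\<Sum>ys\<in>?G. of_int (b ys) * ys ! i) - z * (\<Sum>ys\<in>?G. of_int (d ys) * ys ! i)"
        by (simp add: algebra_simps sum_subtractf sum_distrib_left)
      then show ?thesis
        using d1[OF that] b1[of i] z that False by (cases "i = m") auto
    qed
    ultimately show ?thesis by blast
  qed
qed


section \<open>Volume of a unimodular simplex\<close>

lemma abs_det_eq_1_of_integer_inverse:
  fixes M N :: "real ^ 'n ^ 'n"
  assumes "\<And>i j. M $ i $ j \<in> \<int>" "\<And>i j. N $ i $ j \<in> \<int>" "M ** N = mat 1"
  shows "\<bar>det M\<bar> = 1"
proof -
  have det_Ints: "det A \<in> \<int>" if "\<And>i j. A $ i $ j \<in> \<int>" for A :: "real ^ 'n ^ 'n"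
    unfolding det_def using that by (intro Ints_sum Ints_mult Ints_prod) auto
  obtain a b where ab: "det M = of_int a" "det N = of_int b"
    using det_Ints[of M] det_Ints[of N] assms(1,2) by (metis Ints_cases)
  have "real_of_int (a * b) = 1"
    using det_mul[of M N] assms(3) ab by simp
  then have "a * b = 1" by (simp only: of_int_eq_1_iff)
  then have "\<bar>a\<bar> = 1" by (auto simp: zmult_eq_1_iff)
  then show ?thesis by (simp add: ab(1) flip: of_int_abs)
qed

text \<open>
  Equivalently, the integer affine combinations of the points of \<open>X\<close> are exactly the points of the integer
  lattice, and \<open>X\<close> has as many points as a simplex of full dimension.
\<close>

definition integer_affine_basis :: "(real ^ 'n) set \<Rightarrow> bool" where
  "integer_affine_basis X \<longleftrightarrow> card X = Suc CARD('n) \<and> (\<forall>x\<in>X. \<forall>i. x $ i \<in> \<int>) \<and>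
     (\<forall>k. \<exists>c :: _ \<Rightarrow> int. (\<Sum>x\<in>X. c x) = 0 \<and> (\<Sum>x\<in>X. of_int (c x) *\<^sub>R x) = axis k 1)"

text \<open>
  The coefficients that express the unit vectors by the edges form an integer inverse of the edge matrix:
  as the coefficients sum to zero, replacing each \<open>x\<close> by the edge \<open>x - x\<^sub>0\<close> does not change the
  combination, and it removes the term for \<open>x\<^sub>0\<close>.
\<close>

lemma volume_integer_affine_basis_wellorder:
  fixes X :: "(real ^ 'n::{finite,wellorder}) set"
  assumes "integer_affine_basis X"
  shows "measure lebesgue (convex hull X) = 1 / fact CARD('n)"
proof -
  have card: "card X = Suc CARD('n)" and int: "\<And>x i. x \<in> X \<Longrightarrow> x $ i \<in> \<int>"
    using assms by (auto simp: integer_affine_basis_def)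
  obtain c :: "'n \<Rightarrow> real ^ 'n::_ \<Rightarrow> int" where
    c: "\<And>k. (\<Sum>x\<in>X. c k x) = 0" "\<And>k. (\<Sum>x\<in>X. of_int (c k x) *\<^sub>R x) = axis k 1"
    using assms unfolding integer_affine_basis_def by metis
  have fin: "finite X" by (rule card_ge_0_finite) (simp add: card)
  obtain x0 where x0: "x0 \<in> X" using card by fastforce
  have "card (X - {x0}) = CARD('n)" using card x0 fin by simp
  then obtain f where f: "bij_betw f (UNIV :: 'n set) (X - {x0})"
    using fin by (metis finite_Diff finite finite_same_card_bij)
  define M :: "real ^ 'n::_ ^ 'n::_" where "M = (\<chi> i j. f j $ i - x0 $ i)"
  define N :: "real ^ 'n::_ ^ 'n::_" where "N = (\<chi> j k. of_int (c k (f j)))"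
  have fX: "f j \<in> X" for j using f by (auto simp: bij_betw_def)
  have "(M ** N) $ i $ k = mat 1 $ i $ k" for i k
  proof -
    have "(M ** N) $ i $ k = (\<Sum>j\<in>UNIV. (f j $ i - x0 $ i) * of_int (c k (f j)))"
      by (simp add: M_def N_def matrix_matrix_mult_def)
    also have "\<dots> = (\<Sum>x\<in>X - {x0}. (x $ i - x0 $ i) * of_int (c k x))"
      by (rule sum.reindex_bij_betw[OF f])
    also have "\<dots> = (\<Sum>x\<in>X. (x $ i - x0 $ i) * of_int (c k x))"
      using fin by (intro sum.mono_neutral_left) auto
    also have "\<dots> = (\<Sum>x\<in>X. of_int (c k x) *\<^sub>R x) $ i - x0 $ i * of_int (\<Sum>x\<in>X. c k x)"
      by (simp add: algebra_simps sum_subtractf sum_distrib_left)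
    also have "\<dots> = mat 1 $ i $ k"
      unfolding c by (simp add: axis_def mat_def)
    finally show ?thesis .
  qed
  then have "M ** N = mat 1" by (simp add: vec_eq_iff)
  moreover have "M $ i $ j \<in> \<int>" "N $ i $ j \<in> \<int>" for i j
    using int fX x0 by (auto simp: M_def N_def)
  ultimately have "\<bar>det M\<bar> = 1" by (intro abs_det_eq_1_of_integer_inverse)
  moreover have "measure lborel (convex hull X) = \<bar>det M\<bar> / fact CARD('n)"
    unfolding M_def by (rule content_simplex[OF fin card x0 f])
  moreover have "measure lebesgue (convex hull X) = measure lborel (convex hull X)"
    using fin finite_imp_compact_convex_hull[OF fin]
    by (intro measure_completion) (auto dest: compact_imp_closed)
  ultimately show ?thesis by simp
qed

text \<open>
  Renaming coordinates turns a box into a box with the same side lengths, and Lebesgue measure is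
  determined by its values on boxes.
\<close>

lemma measure_reindex_coordinates:
  fixes S :: "(real ^ 'n) set" and \<sigma> :: "'m::finite \<Rightarrow> 'n"
  assumes \<sigma>: "bij \<sigma>" and S: "compact S"
  shows "measure lebesgue ((\<lambda>x. \<chi> i. x $ \<sigma> i) ` S) = measure lebesgue S"
proof -
  define T :: "real ^ 'n \<Rightarrow> real ^ 'm" where "T = (\<lambda>x. \<chi> i. x $ \<sigma> i)"
  have cont: "continuous_on A T" for A
    unfolding T_def by (intro continuous_intros)
  have meas [measurable]: "T \<in> borel \<rightarrow>\<^sub>M borel"
    by (rule borel_measurable_continuous_onI[OF cont])
  have injT: "inj T"
    using \<sigma> by (intro injI) (metis T_def bij_pointE vec_eq_iff vec_lambda_beta)
  have distr: "lborel = distr lborel borel T"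
  proof (rule lborel_eqI)
    fix l u :: "real ^ 'm"
    assume le: "\<And>b. b \<in> Basis \<Longrightarrow> l \<bullet> b \<le> u \<bullet> b"
    have le': "l $ i \<le> u $ i" for i
      using le[of "axis i 1"] by (simp add: inner_axis axis_in_Basis_iff)
    define l' u' :: "real ^ 'n" where "l' = (\<chi> k. l $ inv \<sigma> k)" and "u' = (\<chi> k. u $ inv \<sigma> k)"
    have inv: "inv \<sigma> (\<sigma> i) = i" "\<sigma> (inv \<sigma> k) = k" for i k
      using \<sigma> by (simp_all add: bij_is_inj bij_is_surj surj_f_inv_f)
    have all_\<sigma>: "(\<forall>k. P k) \<longleftrightarrow> (\<forall>i. P (\<sigma> i))" for P
      by (metis inv(2))
    have "T x \<in> box l u \<longleftrightarrow> x \<in> box l' u'" for x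
      unfolding mem_box_cart all_\<sigma>[of "\<lambda>k. l' $ k < x $ k \<and> x $ k < u' $ k"]
      by (simp add: T_def l'_def u'_def inv)
    then have "T -` box l u = box l' u'" by auto
    then have "emeasure (distr lborel borel T) (box l u) = emeasure lborel (box l' u')"
      by (simp add: emeasure_distr)
    also have "\<dots> = (\<Prod>b\<in>Basis. (u' - l') \<bullet> b)"
      using le' by (intro emeasure_lborel_box) (auto simp: Basis_vec_def inner_axis l'_def u'_def)
    also have "(\<Prod>b\<in>Basis. (u' - l') \<bullet> b) = (\<Prod>k\<in>UNIV. (u' - l') $ k)"
      by (simp add: Basis_vec_def inner_axis prod.reindex_nontrivial prod.UNION_disjoint axis_eq_axis)
    also have "\<dots> = (\<Prod>i\<in>UNIV. (u' - l') $ \<sigma> i)"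
      using prod.reindex_bij_betw[OF \<sigma>, of "\<lambda>k. (u' - l') $ k"] by simp
    also have "\<dots> = (\<Prod>i\<in>UNIV. (u - l) $ i)"
      by (simp add: l'_def u'_def inv)
    also have "\<dots> = (\<Prod>b\<in>Basis. (u - l) \<bullet> b)"
      by (simp add: Basis_vec_def inner_axis prod.reindex_nontrivial prod.UNION_disjoint axis_eq_axis)
    finally show "emeasure (distr lborel borel T) (box l u) = (\<Prod>b\<in>Basis. (u - l) \<bullet> b)" .
  qed simp
  have TS: "compact (T ` S)" by (rule compact_continuous_image[OF cont S])
  have "measure lborel (T ` S) = measure (distr lborel borel T) (T ` S)"
    using arg_cong[OF distr, of "\<lambda>M. measure M (T ` S)"] .
  also have "\<dots> = measure lborel (T -` (T ` S))"
    using TS by (subst measure_distr) (auto simp: borel_compact)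
  finally have "measure lborel (T ` S) = measure lborel (T -` (T ` S))" .
  then have "measure lborel (T ` S) = measure lborel S"
    by (simp add: inj_vimage_image_eq[OF injT])
  then show ?thesis
    using S TS by (simp add: T_def measure_completion borel_compact)
qed

text \<open>
  A copy of a type that carries the order of an arbitrary numbering of its elements, so that a finite
  index type without an order can be exchanged for a well-ordered one.
\<close>

datatype 'a enumerated = Enumerated (underlying: 'a)

lemma bij_underlying: "bij underlying"
  by (rule bijI') (auto intro: enumerated.expand enumerated.sel[symmetric])

instance enumerated :: (finite) finite
  by standard (metis bij_underlying bij_betw_finite finite)

instantiation enumerated :: (finite) wellorder
begin

definition less_eq_enumerated :: "'a enumerated \<Rightarrow> 'a enumerated \<Rightarrow> bool" where
  "x \<le> y \<longleftrightarrow> to_nat (underlying x) \<le> to_nat (underlying y)"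

definition less_enumerated :: "'a enumerated \<Rightarrow> 'a enumerated \<Rightarrow> bool" where
  "x < y \<longleftrightarrow> to_nat (underlying x) < to_nat (underlying y)"

instance
proof
  fix P :: "'a enumerated \<Rightarrow> bool" and a
  assume step: "\<And>x. (\<And>y. y < x \<Longrightarrow> P y) \<Longrightarrow> P x"
  show "P a"
    by (induction a rule: measure_induct_rule[of "\<lambda>x. to_nat (underlying x)"])
      (rule step, simp add: less_enumerated_def)
qed (auto simp: less_eq_enumerated_def less_enumerated_def intro: enumerated.expand)

end

lemma volume_integer_affine_basis:
  fixes X :: "(real ^ 'n) set"
  assumes X: "integer_affine_basis X"
  shows "measure lebesgue (convex hull X) = 1 / fact CARD('n)"
proof -
  define T :: "real ^ 'n \<Rightarrow> real ^ 'n enumerated" where "T = (\<lambda>x. \<chi> i. x $ underlying i)"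
  have lin: "linear T"
    by (rule linearI) (simp_all add: T_def vec_eq_iff)
  have injT: "inj T"
    by (intro injI) (metis T_def enumerated.sel vec_eq_iff vec_lambda_beta)
  have card: "CARD('n enumerated) = CARD('n)"
    by (rule bij_betw_same_card[OF bij_underlying])
  have fin: "finite X"
    using X by (intro card_ge_0_finite) (simp add: integer_affine_basis_def)
  have "integer_affine_basis (T ` X)"
    unfolding integer_affine_basis_def
  proof (intro conjI allI)
    show "card (T ` X) = Suc CARD('n enumerated)"
      using X injT by (simp add: card card_image inj_on_subset integer_affine_basis_def)
    show "\<forall>x\<in>T ` X. \<forall>i. x $ i \<in> \<int>"
      using X by (auto simp: T_def integer_affine_basis_def)
    fix k :: "'n enumerated"
    obtain c :: "_ \<Rightarrow> int" where c: "(\<Sum>x\<in>X. c x) = 0"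
        "(\<Sum>x\<in>X. of_int (c x) *\<^sub>R x) = axis (underlying k) 1"
      using X unfolding integer_affine_basis_def by metis
    have "(\<Sum>y\<in>T ` X. c (inv T y)) = 0"
      using c(1) injT by (simp add: sum.reindex inj_on_subset)
    moreover have "(\<Sum>y\<in>T ` X. of_int (c (inv T y)) *\<^sub>R y) = axis k 1"
    proof -
      have "(\<Sum>y\<in>T ` X. of_int (c (inv T y)) *\<^sub>R y) = T (\<Sum>x\<in>X. of_int (c x) *\<^sub>R x)"
        using injT by (simp add: sum.reindex inj_on_subset linear_sum[OF lin] linear_scale[OF lin])
      also have "\<dots> = axis k 1"
        unfolding c(2) by (auto simp: T_def axis_def vec_eq_iff enumerated.expand)
      finally show ?thesis .
    qed
    ultimately show "\<exists>c :: _ \<Rightarrow> int. (\<Sum>x\<in>T ` X. c x) = 0 \<and>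
        (\<Sum>x\<in>T ` X. of_int (c x) *\<^sub>R x) = axis k 1"
      by (intro exI[of _ "\<lambda>y. c (inv T y)"]) auto
  qed
  then have "measure lebesgue (convex hull (T ` X)) = 1 / fact CARD('n)"
    using volume_integer_affine_basis_wellorder card by metis
  moreover have "convex hull (T ` X) = T ` (convex hull X)"
    by (rule convex_hull_linear_image[OF lin, symmetric])
  moreover have "measure lebesgue (T ` (convex hull X)) = measure lebesgue (convex hull X)"
    unfolding T_def
    by (rule measure_reindex_coordinates[OF bij_underlying finite_imp_compact_convex_hull[OF fin]])
  ultimately show ?thesis by simp
qed


section \<open>Simplices of Sturmian factors\<close>

theorem theorem1p1:
  fixes W :: "nat \<Rightarrow> real" and n :: nat and e :: "'n::finite \<Rightarrow> nat"
  assumes "sturmian W"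
    and "n \<ge> 1"
    and "bij_betw e UNIV {..<n}"
  shows "measure lebesgue (convex hull (vec_of_list e ` factors n W)) = 1 / fact n"
proof -
  let ?F = "factors n W"
  have card: "CARD('n) = n" using bij_betw_same_card[OF assms(3)] by simp
  have e_less: "e k < n" for k using assms(3) by (auto simp: bij_betw_def)
  have inj: "inj_on (vec_of_list e) ?F"
  proof (rule inj_onI)
    fix xs ys assume "xs \<in> ?F" "ys \<in> ?F" and eq: "vec_of_list e xs = vec_of_list e ys"
    then have len: "length xs = n" "length ys = n" by (simp_all add: length_factor)
    have "xs ! i = ys ! i" if "i < n" for i
    proof -
      have "i \<in> range e" using bij_betw_imp_surj_on[OF assms(3)] that by simp
      then obtain k where "e k = i" by blast
      then show ?thesis using eq by (auto simp: vec_of_list_def vec_eq_iff)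
    qed
    then show "xs = ys" using len by (simp add: list_eq_iff_nth_eq)
  qed
  have "integer_affine_basis (vec_of_list e ` ?F)"
    unfolding integer_affine_basis_def
  proof (intro conjI allI)
    show "card (vec_of_list e ` ?F) = Suc CARD('n)"
      by (simp add: card card_image[OF inj] card_factors[OF assms(1)])
    show "\<forall>x\<in>vec_of_list e ` ?F. \<forall>i. x $ i \<in> \<int>"
      using nth_factor_Ints[OF assms(1)] e_less by (auto simp: vec_of_list_def)
    fix k
    obtain c :: "real list \<Rightarrow> int" where c: "(\<Sum>xs\<in>?F. c xs) = 0"
        "\<And>i. i < n \<Longrightarrow> (\<Sum>xs\<in>?F. of_int (c xs) * xs ! i) = (if i = e k then 1 else 0)"
      using unit_vector_factor_combination[OF assms(1) e_less] by blast
    let ?c = "\<lambda>x. c (inv_into ?F (vec_of_list e) x)"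
    have "(\<Sum>x\<in>vec_of_list e ` ?F. ?c x) = 0"
      using c(1) by (simp add: sum.reindex[OF inj] inv_into_f_f[OF inj])
    moreover have "(\<Sum>x\<in>vec_of_list e ` ?F. of_int (?c x) *\<^sub>R x) = axis k 1"
    proof -
      have "(\<Sum>x\<in>vec_of_list e ` ?F. of_int (?c x) *\<^sub>R x)
          = (\<Sum>xs\<in>?F. of_int (c xs) *\<^sub>R vec_of_list e xs)"
        by (simp add: sum.reindex[OF inj] inv_into_f_f[OF inj])
      also have "\<dots> $ j = axis k 1 $ j" for j
        using c(2)[OF e_less[of j]] bij_betw_imp_inj_on[OF assms(3)]
        by (simp add: vec_of_list_def axis_def inj_eq)
      then have "(\<Sum>xs\<in>?F. of_int (c xs) *\<^sub>R vec_of_list e xs) = axis k 1"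
        by (simp add: vec_eq_iff)
      finally show ?thesis .
    qed
    ultimately show "\<exists>c :: _ \<Rightarrow> int. (\<Sum>x\<in>vec_of_list e ` ?F. c x) = 0 \<and>
        (\<Sum>x\<in>vec_of_list e ` ?F. of_int (c x) *\<^sub>R x) = axis k 1"
      by (intro exI[of _ ?c]) auto
  qed
  then show ?thesis using volume_integer_affine_basis card by metis
qed

end
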